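(* Let $\mathcal{A}=((A_\xi)_{\xi\in I},\mathcal{F})$ be an algebra such that $\mathcal{F}=\bigcup_{\xi\in I}\mathcal{G}_\xi$. Then: (1) For each $\eta\in I$ and each $\vec e\in\Omega_\eta$, $\mathcal{A}$ is an $\vec e$-Ramsey algebra if and only if $(A_\eta,\mathcal{G}_\eta)$ is a Ramsey algebra. (2) Suppose $\vec e\notin\Omega$. Then $\mathcal{A}$ is an $\vec e$-Ramsey algebra if and only if every element of $A_{\vec e(0)}$ can be sent into the set $S_{\vec e(0)}=\{c\in A_{\vec e(0)}:f(c)=c\text{ for each unary }f\in\mathcal{G}_{\vec e(0)}\}$ by finitely many applications of the unary operations in $\mathcal{G}_{\vec e(0)}$. In particular, if $\mathcal{G}_{\vec e(0)}$ has no unary operations, then $S_{\vec e(0)}=A_{\vec e(0)}$ and $\mathcal{A}$ is an $\vec e$-Ramsey algebra.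
   Context: An algebra $((A_\xi)_{\xi\in I},\mathcal{F})$ consists of pairwise disjoint nonempty sets $A_\xi$ (phyla) and a family $\mathcal{F}$ of operations, each from a finite product of phyla into a phylum. For $\xi\in I$, $\mathcal{G}_\xi=\{f\in\mathcal{F}:\mathrm{dom}(f)=A_\xi^n\text{ for some }n\in\omega\text{ and the codomain of }f\text{ is }A_\xi\}$. Orderly terms $\mathrm{OT}(\mathcal{H})$ over a family $\mathcal{H}$: smallest collection containing $\mathcal{H}$ and all identity maps $\mathrm{id}_{A_\xi}$, closed under $f(\bar x_1,\dots,\bar x_k)=g(h_1(\bar x_1),\dots,h_k(\bar x_k))$ for $k$-ary $g\in\mathcal{H}$, orderly terms $h_i$ with codomains matching $g$'s arguments, and consecutive disjoint variable blocks $\bar x_i$. $\vec a\le_\mathcal{H}\vec b$ means there are orderly terms $f_j$ over $\mathcal{H}$ and finite subsequences $\vec b_j$ of $\vec b$ with $\vec a(j)=f_j(\bar b_j)$ for all $j$ and $\vec b_0\ast\vec b_1\ast\cdots$ a subsequence of $\vec b$. A sort is $\vec e\in{}^\omega I$; $\vec a$ is $\vec e$-sorted if $\vec a(n)\in A_{\vec e(n)}$ for all $n$. $\mathrm{FR}^{\vec e}_\mathcal{F}(\vec b)=\{\vec a(0):\vec a\le_\mathcal{F}\vec b,\ \vec a\ \vec e\text{-sorted}\}$. $\mathcal{A}$ is an $\vec e$-Ramsey algebra if for every $\vec e$-sorted $\vec b$ and $X\subseteq A_{\vec e(0)}$ there is an $\vec e$-sorted $\vec a\le_\mathcal{F}\vec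 b$ with $\mathrm{FR}^{\vec e}_\mathcal{F}(\vec a)\subseteq X$ or disjoint from $X$. A homogeneous algebra $(A,\mathcal{H})$ is a Ramsey algebra if for every $\vec b\in{}^\omega A$ and $X\subseteq A$ there is $\vec a\le_\mathcal{H}\vec b$ with $\mathrm{FR}_\mathcal{H}(\vec a)=\{f(\bar\tau):f\in\mathrm{OT}(\mathcal{H}),\ \vec\tau\text{ a finite subsequence of }\vec a\}$ contained in or disjoint from $X$. $\Omega$ is the set of sorts in which every occurring index occurs infinitely often, and $\Omega_\eta=\{\vec e\in\Omega:\vec e(0)=\eta\}$.
   Formalization: Operations are assumed to have arity at least 1 (no nullary operations); with constants, part (2) fails, e.g. for the naturals with + and the constant 1, a second phylum without operations, and a sort in which the first index occurs only once. *)

theory Defs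
  imports Main "HOL-Library.FuncSet" "HOL-Library.Disjoint_Sets"
begin

text \<open>
  An operation from the finite product of the phyla listed in \<open>op_dom\<close> (one index per argument
  place) into the phylum \<open>op_cod\<close>. Tuples are lists; values of \<open>op_fun\<close> on lists outside the
  product carry no meaning and are never consulted. Since phyla are nonempty and pairwise
  disjoint, recording the indices amounts to recording domain and codomain as sets.
\<close>

datatype ('i, 'a) operation =
  Operation (op_dom: "'i list") (op_cod: 'i) (op_fun: "'a list \<Rightarrow> 'a")

definition tuples :: "('i \<Rightarrow> 'a set) \<Rightarrow> 'i list \<Rightarrow> 'a list set" where
  "tuples A is = {xs. list_all2 (\<lambda>x \<xi>. x \<in> A \<xi>) xs is}"

text \<open>
  No operation is nullary, as is standard for Ramsey algebras. (With constants allowed, a constant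
  plugged into a binary operation yields a new unary orderly term, and the characterisation of
  the Ramsey property by unary operations fails.)
\<close>

locale heterogeneous_algebra =
  fixes I :: "'i set" and A :: "'i \<Rightarrow> 'a set" and F :: "('i, 'a) operation set"
  assumes phylum_nonempty: "\<xi> \<in> I \<Longrightarrow> A \<xi> \<noteq> {}"
    and phyla_disjoint: "disjoint_family_on A I"
    and op_dom_nonempty: "f \<in> F \<Longrightarrow> op_dom f \<noteq> []"
    and op_dom_indices: "f \<in> F \<Longrightarrow> set (op_dom f) \<subseteq> I"
    and op_cod_index: "f \<in> F \<Longrightarrow> op_cod f \<in> I"
    and op_fun_maps: "f \<in> F \<Longrightarrow> op_fun f \<in> tuples A (op_dom f) \<rightarrow> A (op_cod f)"

definition homogeneous_ops :: "('i, 'a) operation set \<Rightarrow> 'i \<Rightarrow> ('i, 'a) operation set" where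
  "homogeneous_ops F \<xi> = {f \<in> F. (\<exists>n. op_dom f = replicate n \<xi>) \<and> op_cod f = \<xi>}"

fun apply_blocks :: "('i, 'a) operation list \<Rightarrow> 'a list \<Rightarrow> 'a list" where
  "apply_blocks [] xs = []"
| "apply_blocks (h # hs) xs =
     op_fun h (take (length (op_dom h)) xs) # apply_blocks hs (drop (length (op_dom h)) xs)"

definition orderly_comp ::
    "('i, 'a) operation \<Rightarrow> ('i, 'a) operation list \<Rightarrow> ('i, 'a) operation" where
  "orderly_comp g hs =
     Operation (concat (map op_dom hs)) (op_cod g) (\<lambda>xs. op_fun g (apply_blocks hs xs))"

inductive_set orderly_terms :: "'i set \<Rightarrow> ('i, 'a) operation set \<Rightarrow> ('i, 'a) operation set"
  for I :: "'i set" and H :: "('i, 'a) operation set" where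
  basic: "f \<in> H \<Longrightarrow> f \<in> orderly_terms I H"
| ident: "\<xi> \<in> I \<Longrightarrow> Operation [\<xi>] \<xi> hd \<in> orderly_terms I H"
| comp: "g \<in> H \<Longrightarrow> (\<forall>h \<in> set hs. h \<in> orderly_terms I H) \<Longrightarrow> map op_cod hs = op_dom g \<Longrightarrow>
    orderly_comp g hs \<in> orderly_terms I H"

text \<open>
  The last conjunct says that the infinite concatenation of the finite sequences
  \<open>bs 0\<close>, \<open>bs 1\<close>, \<dots> is the subsequence \<open>b \<circ> \<sigma>\<close> of \<open>b\<close>.
\<close>

definition reduction ::
    "'i set \<Rightarrow> ('i \<Rightarrow> 'a set) \<Rightarrow> ('i, 'a) operation set \<Rightarrow> (nat \<Rightarrow> 'a) \<Rightarrow> (nat \<Rightarrow> 'a) \<Rightarrow> bool" where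
  "reduction I A H a b \<longleftrightarrow>
     (\<exists>f bs. (\<forall>j. f j \<in> orderly_terms I H \<and> bs j \<in> tuples A (op_dom (f j)) \<and>
                  a j = op_fun (f j) (bs j)) \<and>
        (\<exists>\<sigma>. strict_mono \<sigma> \<and>
           (\<forall>j. bs j = map (b \<circ> \<sigma>) [(\<Sum>i<j. length (bs i)) ..< (\<Sum>i\<le>j. length (bs i))])))"

definition sorts :: "'i set \<Rightarrow> (nat \<Rightarrow> 'i) set" where
  "sorts I = {e. range e \<subseteq> I}"

definition sorted_by :: "('i \<Rightarrow> 'a set) \<Rightarrow> (nat \<Rightarrow> 'i) \<Rightarrow> (nat \<Rightarrow> 'a) \<Rightarrow> bool" where
  "sorted_by A e a \<longleftrightarrow> (\<forall>n. a n \<in> A (e n))"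

definition FR_sorted ::
    "'i set \<Rightarrow> ('i \<Rightarrow> 'a set) \<Rightarrow> ('i, 'a) operation set \<Rightarrow> (nat \<Rightarrow> 'i) \<Rightarrow> (nat \<Rightarrow> 'a) \<Rightarrow> 'a set" where
  "FR_sorted I A F e b = {a 0 | a. reduction I A F a b \<and> sorted_by A e a}"

definition sorted_Ramsey_algebra ::
    "'i set \<Rightarrow> ('i \<Rightarrow> 'a set) \<Rightarrow> ('i, 'a) operation set \<Rightarrow> (nat \<Rightarrow> 'i) \<Rightarrow> bool" where
  "sorted_Ramsey_algebra I A F e \<longleftrightarrow>
     (\<forall>b X. sorted_by A e b \<and> X \<subseteq> A (e 0) \<longrightarrow>
        (\<exists>a. sorted_by A e a \<and> reduction I A F a b \<and>
           (FR_sorted I A F e a \<subseteq> X \<or> FR_sorted I A F e a \<inter> X = {})))"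

text \<open>
  A homogeneous algebra \<open>(C, H)\<close> is an algebra whose only phylum is \<open>C\<close>; \<open>\<eta>\<close> is the index naming
  that phylum in the domains and codomains of the operations in \<open>H\<close>.
\<close>

definition FR :: "'i \<Rightarrow> 'a set \<Rightarrow> ('i, 'a) operation set \<Rightarrow> (nat \<Rightarrow> 'a) \<Rightarrow> 'a set" where
  "FR \<eta> C H a =
     {op_fun f (map a ks) | f ks. f \<in> orderly_terms {\<eta>} H \<and> sorted_wrt (<) ks \<and>
        map a ks \<in> tuples (\<lambda>_. C) (op_dom f)}"

definition Ramsey_algebra :: "'i \<Rightarrow> 'a set \<Rightarrow> ('i, 'a) operation set \<Rightarrow> bool" where
  "Ramsey_algebra \<eta> C H \<longleftrightarrow>
     (\<forall>b X. range b \<subseteq> C \<and> X \<subseteq> C \<longrightarrow>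
        (\<exists>a. range a \<subseteq> C \<and> reduction {\<eta>} (\<lambda>_. C) H a b \<and>
           (FR \<eta> C H a \<subseteq> X \<or> FR \<eta> C H a \<inter> X = {})))"

definition Omega :: "'i set \<Rightarrow> (nat \<Rightarrow> 'i) set" where
  "Omega I = {e \<in> sorts I. \<forall>\<xi> \<in> range e. infinite {n. e n = \<xi>}}"

definition Omega_at :: "'i set \<Rightarrow> 'i \<Rightarrow> (nat \<Rightarrow> 'i) set" where
  "Omega_at I \<eta> = {e \<in> Omega I. e 0 = \<eta>}"

definition unary_ops :: "('i, 'a) operation set \<Rightarrow> ('i, 'a) operation set" where
  "unary_ops H = {f \<in> H. length (op_dom f) = 1}"

definition fixed_points ::
    "('i \<Rightarrow> 'a set) \<Rightarrow> ('i, 'a) operation set \<Rightarrow> 'i \<Rightarrow> 'a set" where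
  "fixed_points A F \<eta> =
     {c \<in> A \<eta>. \<forall>f \<in> unary_ops (homogeneous_ops F \<eta>). op_fun f [c] = c}"

end

theory Submission
  imports Defs "HOL-Library.Infinite_Set"
begin

text \<open>
  As every operation lives on one phylum, each entry of a sorted reduction is computed from entries
  of its own sort only. If every index recurs, the reduction on the phylum \<open>A \<eta>\<close> can be carried out
  at the positions of sort \<open>\<eta>\<close>, while identities supply entries of the other sorts far enough out.
  If some index stops occurring, its last position forces the first block to be \<open>[0]\<close>, so only unary
  operations act on the first entry; a map without fixed points along an orbit then admits a
  two-colouring that every forward orbit sees in full, which refutes the Ramsey property.
\<close>

section \<open>Reductions in terms of increasing blocks of indices\<close>

text \<open>Positions are recorded instead of values, because a sequence may repeat values. A block
  may skip positions. Nonemptiness keeps \<open>hd\<close> and \<open>last\<close> meaningful, so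
  comparing neighbouring blocks orders all of them.\<close>

definition increasing_blocks :: "(nat \<Rightarrow> nat list) \<Rightarrow> bool" where
  "increasing_blocks ks \<longleftrightarrow>
     (\<forall>j. ks j \<noteq> [] \<and> sorted_wrt (<) (ks j) \<and> last (ks j) < hd (ks (Suc j)))"

lemma sorted_wrt_less_hd_le:
  fixes xs :: "nat list"
  assumes "sorted_wrt (<) xs" and "x \<in> set xs"
  shows "hd xs \<le> x"
  using assms by (cases xs) auto

lemma sorted_wrt_less_le_last:
  fixes xs :: "nat list"
  assumes "sorted_wrt (<) xs" and "x \<in> set xs"
  shows "x \<le> last xs"
  using assms by (induction xs) (auto, metis last_in_set less_imp_le)

text \<open>Each block in between is nonempty and pushes the positions up by at least one. The
  quantitative bound, not just the order, is what later confines the first block to position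
  0.\<close>

lemma increasing_blocks_gap:
  assumes "increasing_blocks ks" and "x \<in> set (ks i)" and "y \<in> set (ks (i + d))" and "0 < d"
  shows "x + d \<le> y"
  using assms(3,4)
proof (induction d arbitrary: y)
  case (Suc d)
  have less: "z < y" if "z \<in> set (ks (i + d))" for z
  proof -
    have "z \<le> last (ks (i + d))"
      using assms(1) that sorted_wrt_less_le_last unfolding increasing_blocks_def by blast
    also have "\<dots> < hd (ks (Suc (i + d)))"
      using assms(1) unfolding increasing_blocks_def by blast
    also have "\<dots> \<le> y"
      using assms(1) Suc.prems(1) sorted_wrt_less_hd_le
      unfolding increasing_blocks_def add_Suc_right by blast
    finally show ?thesis .
  qed
  show ?case
  proof (cases "d = 0")
    case True
    then show ?thesis using less assms(2) by force
  next
    case False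
    have "last (ks (i + d)) \<in> set (ks (i + d))"
      using assms(1) unfolding increasing_blocks_def by simp
    with Suc.IH[OF this] less[OF this] False show ?thesis by simp
  qed
qed simp

lemma increasing_blocks_less:
  assumes "increasing_blocks ks" and "i < j" and "x \<in> set (ks i)" and "y \<in> set (ks j)"
  shows "x < y"
  using increasing_blocks_gap[of ks x i y "j - i"] assms by force

lemma increasing_blocks_ge_index:
  assumes "increasing_blocks ks" and "x \<in> set (ks j)"
  shows "j \<le> x"
proof (cases "j = 0")
  case False
  have "hd (ks 0) \<in> set (ks 0)"
    using assms(1) unfolding increasing_blocks_def by simp
  from increasing_blocks_gap[OF assms(1) this, of x j] assms(2) False show ?thesis by simp
qed simp

text \<open>Monotonicity is asked only on positions that occur in the blocks, so that the lemma also
  applies to \<open>inv p\<close>, which is controlled only on the range of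
  \<open>p\<close>.\<close>

lemma increasing_blocks_map:
  assumes "increasing_blocks ks"
    and "\<And>i j x y. x \<in> set (ks i) \<Longrightarrow> y \<in> set (ks j) \<Longrightarrow> x < y \<Longrightarrow> p x < p y"
  shows "increasing_blocks (\<lambda>j. map p (ks j))"
proof -
  have ks: "ks j \<noteq> []" "sorted_wrt (<) (ks j)" "last (ks j) < hd (ks (Suc j))" for j
    using assms(1) unfolding increasing_blocks_def by auto
  have "sorted_wrt (<) (map p (ks j))" for j
    unfolding sorted_wrt_map using ks(2)[of j]
    by (rule sorted_wrt_mono_rel[rotated]) (use assms(2) in blast)
  moreover have "p (last (ks j)) < p (hd (ks (Suc j)))" for j
    using assms(2) ks by (meson last_in_set hd_in_set)
  ultimately show ?thesis
    unfolding increasing_blocks_def using ks(1) by (simp add: last_map hd_map)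
qed

text \<open>Reading the blocks one after another enumerates their positions increasingly;
  \<open>\<sigma>\<close> is this enumeration.\<close>

lemma increasing_blocks_concat:
  assumes "increasing_blocks ks"
  obtains \<sigma> where "strict_mono \<sigma>"
    and "\<And>j. ks j = map \<sigma> [(\<Sum>i<j. length (ks i)) ..< (\<Sum>i\<le>j. length (ks i))]"
proof -
  define S where "S j = (\<Sum>i<j. length (ks i))" for j
  have ne: "ks j \<noteq> []" and sorted: "sorted_wrt (<) (ks j)" for j
    using assms unfolding increasing_blocks_def by auto
  have S_Suc: "S (Suc j) = S j + length (ks j)" for j
    by (simp add: S_def)
  have "strict_mono S"
    unfolding strict_mono_Suc_iff using ne by (simp add: S_Suc)
  \<comment> \<open>\<open>S j\<close> is the place in the concatenation where block
    \<open>j\<close> starts, so \<open>B n\<close> is the block that contains place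
    \<open>n\<close>. The greatest such \<open>j\<close> exists because \<open>S\<close> grows at
    least as fast as the identity.\<close>
  define B where "B n = (GREATEST j. S j \<le> n)" for n
  have bound: "S j \<le> n \<Longrightarrow> j \<le> n" for j n
    using strict_mono_imp_increasing[OF \<open>strict_mono S\<close>, of j] by simp
  have "S 0 \<le> n" for n by (simp add: S_def)
  then have B_le: "S (B n) \<le> n" for n
    unfolding B_def by (rule GreatestI_nat) (rule bound)
  have B_less: "n < S (Suc (B n))" for n
  proof (rule ccontr)
    assume "\<not> n < S (Suc (B n))"
    then have "Suc (B n) \<le> B n"
      unfolding B_def by (intro Greatest_le_nat) (auto intro: bound)
    then show False by simp
  qed
  have B_eq: "B n = j" if "S j \<le> n" "n < S (Suc j)" for n j
    using that B_le[of n] B_less[of n] \<open>strict_mono S\<close>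
    by (meson antisym less_Suc_eq_le order.strict_trans1 strict_mono_less)
  define \<sigma> where "\<sigma> n = ks (B n) ! (n - S (B n))" for n
  have idx: "n - S (B n) < length (ks (B n))" for n
    using B_less[of n] B_le[of n] by (simp add: S_Suc)
  have "\<sigma> m < \<sigma> n" if "m < n" for m n
  \<comment> \<open>Within one block the order comes from its sortedness, across blocks from the
    order of the blocks.\<close>
  proof (cases "B m = B n")
    case True
    then have "m - S (B m) < n - S (B n)"
      using that B_le[of m] by simp
    then show ?thesis
      unfolding \<sigma>_def True using sorted idx[of n] by (simp add: sorted_wrt_iff_nth_less)
  next
    case False
    have "S (B m) < S (Suc (B n))"
      using B_le[of m] B_less[of n] that by linarith
    then have "B m < B n"
      using False \<open>strict_mono S\<close> by (simp add: strict_mono_less)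
    then show ?thesis
      unfolding \<sigma>_def using increasing_blocks_less[OF assms] idx nth_mem by blast
  qed
  then have "strict_mono \<sigma>"
    by (simp add: strict_mono_def)
  moreover have "ks j = map \<sigma> [(\<Sum>i<j. length (ks i)) ..< (\<Sum>i\<le>j. length (ks i))]" for j
  proof -
    have "ks j = map \<sigma> [S j ..< S (Suc j)]"
    proof (rule nth_equalityI)
      fix i assume i: "i < length (ks j)"
      then have "B (S j + i) = j"
        by (intro B_eq) (auto simp: S_Suc)
      with i show "ks j ! i = map \<sigma> [S j..<S (Suc j)] ! i"
        by (simp add: S_Suc \<sigma>_def)
    qed (simp add: S_Suc)
    then show ?thesis
      by (simp add: S_def lessThan_Suc_atMost)
  qed
  ultimately show thesis by (rule that)
qed

lemma length_tuples: "xs \<in> tuples A is \<Longrightarrow> length xs = length is"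
  unfolding tuples_def by (auto dest: list_all2_lengthD)

text \<open>This trades the one global embedding \<open>\<sigma>\<close> for a condition on
  consecutive blocks, which can be met recursively. Terms with nonempty domain consume nonempty
  blocks.\<close>

lemma reduction_iff_blocks:
  assumes "\<And>f. f \<in> orderly_terms I H \<Longrightarrow> op_dom f \<noteq> []"
  shows "reduction I A H a b \<longleftrightarrow>
    (\<exists>f ks. increasing_blocks ks \<and>
       (\<forall>j. f j \<in> orderly_terms I H \<and> map b (ks j) \<in> tuples A (op_dom (f j)) \<and>
            a j = op_fun (f j) (map b (ks j))))"
proof
  assume "reduction I A H a b"
  then obtain f bs \<sigma> where fb: "\<And>j. f j \<in> orderly_terms I H"
      "\<And>j. bs j \<in> tuples A (op_dom (f j))" "\<And>j. a j = op_fun (f j) (bs j)"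
    and \<sigma>: "strict_mono \<sigma>"
    and bs: "\<And>j. bs j = map (b \<circ> \<sigma>) [(\<Sum>i<j. length (bs i)) ..< (\<Sum>i\<le>j. length (bs i))]"
    unfolding reduction_def by blast
  define S where "S j = (\<Sum>i<j. length (bs i))" for j
  define ks where "ks j = map \<sigma> [S j ..< S (Suc j)]" for j
  have bs_ks: "bs j = map b (ks j)" for j
    using bs[of j] by (simp add: ks_def S_def lessThan_Suc_atMost)
  have "bs j \<noteq> []" for j
    using assms[OF fb(1)] length_tuples[OF fb(2)] by (metis length_0_conv)
  then have S_less: "S j < S (Suc j)" for j
    by (simp add: S_def)
  have "increasing_blocks ks"
    unfolding increasing_blocks_def
  proof (intro allI conjI)
    fix j
    show "ks j \<noteq> []" using S_less[of j] by (simp add: ks_def)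
    show "sorted_wrt (<) (ks j)"
      unfolding ks_def sorted_wrt_map
      by (rule sorted_wrt_mono_rel[OF _ sorted_wrt_upt]) (use \<sigma> in \<open>simp add: strict_mono_less\<close>)
    show "last (ks j) < hd (ks (Suc j))"
      using S_less[of j] S_less[of "Suc j"] \<sigma>
      by (simp add: ks_def last_map hd_map strict_mono_less)
  qed
  with fb bs_ks show "\<exists>f ks. increasing_blocks ks \<and>
       (\<forall>j. f j \<in> orderly_terms I H \<and> map b (ks j) \<in> tuples A (op_dom (f j)) \<and>
            a j = op_fun (f j) (map b (ks j)))"
    by metis
next
  assume "\<exists>f ks. increasing_blocks ks \<and>
       (\<forall>j. f j \<in> orderly_terms I H \<and> map b (ks j) \<in> tuples A (op_dom (f j)) \<and>
            a j = op_fun (f j) (map b (ks j)))"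
  then obtain f ks where ks: "increasing_blocks ks"
    and f: "\<forall>j. f j \<in> orderly_terms I H \<and> map b (ks j) \<in> tuples A (op_dom (f j)) \<and>
            a j = op_fun (f j) (map b (ks j))" by blast
  obtain \<sigma> where \<sigma>: "strict_mono \<sigma>"
    and eq: "\<And>j. ks j = map \<sigma> [(\<Sum>i<j. length (ks i)) ..< (\<Sum>i\<le>j. length (ks i))]"
    using increasing_blocks_concat[OF ks] by blast
  have "map b (ks j) = map (b \<circ> \<sigma>) [(\<Sum>i<j. length (map b (ks i))) ..<
      (\<Sum>i\<le>j. length (map b (ks i)))]" for j
    using arg_cong[OF eq[of j], of "map b"] by simp
  with f \<sigma> show "reduction I A H a b"
    unfolding reduction_def by (intro exI[of _ f] exI[of _ "\<lambda>j. map b (ks j)"]) blast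
qed

section \<open>Orderly terms when every operation lives on a single phylum\<close>

lemma tuples_replicate: "tuples A (replicate n \<xi>) = {xs. length xs = n \<and> set xs \<subseteq> A \<xi>}"
  unfolding tuples_def by (auto simp: list_all2_conv_all_nth in_set_conv_nth subset_iff)

lemma orderly_terms_mono:
  assumes "f \<in> orderly_terms J G" and "J \<subseteq> I" and "G \<subseteq> H"
  shows "f \<in> orderly_terms I H"
  using assms(1)
  by induction (use assms(2,3) in \<open>auto intro: orderly_terms.intros\<close>)

lemma apply_blocks_tuples:
  assumes "\<And>h. h \<in> set hs \<Longrightarrow> op_fun h \<in> tuples A (op_dom h) \<rightarrow> A (op_cod h)"
    and "xs \<in> tuples A (concat (map op_dom hs))"
  shows "apply_blocks hs xs \<in> tuples A (map op_cod hs)"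
  using assms
proof (induction hs arbitrary: xs)
  case Nil
  then show ?case by (simp add: tuples_def)
next
  case (Cons h hs)
  have "list_all2 (\<lambda>x \<xi>. x \<in> A \<xi>) xs (op_dom h @ concat (map op_dom hs))"
    using Cons.prems(2) by (simp add: tuples_def)
  then obtain us vs where uv: "xs = us @ vs" "length us = length (op_dom h)"
      "us \<in> tuples A (op_dom h)" "vs \<in> tuples A (concat (map op_dom hs))"
    unfolding list_all2_append2 tuples_def by auto
  have "apply_blocks hs vs \<in> tuples A (map op_cod hs)"
    using Cons.IH[OF _ uv(4)] Cons.prems(1) by simp
  moreover have "op_fun h us \<in> A (op_cod h)"
    using Cons.prems(1)[of h] uv(3) by auto
  ultimately show ?case
    using uv(1,2) by (simp add: tuples_def)
qed

section \<open>Algebras whose operations each stay inside one phylum\<close>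

locale phylumwise_algebra = heterogeneous_algebra I A F
  for I :: "'i set" and A :: "'i \<Rightarrow> 'a set" and F :: "('i, 'a) operation set" +
  assumes phylumwise: "F = (\<Union>\<xi>\<in>I. homogeneous_ops F \<xi>)"
begin

abbreviation unary_iterate :: "('i, 'a) operation list \<Rightarrow> 'a \<Rightarrow> 'a" where
  "unary_iterate \<equiv> fold (\<lambda>f x. op_fun f [x])"

lemma op_dom_replicate:
  assumes "f \<in> F"
  obtains n where "op_dom f = replicate (Suc n) (op_cod f)"
proof -
  from assms phylumwise obtain \<xi> n where "op_dom f = replicate n \<xi>" "op_cod f = \<xi>"
    unfolding homogeneous_ops_def by blast
  moreover from this op_dom_nonempty[OF assms] obtain m where "n = Suc m"
    by (cases n) auto
  ultimately show thesis using that by blast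
qed

lemma op_in_homogeneous_ops: "f \<in> F \<Longrightarrow> f \<in> homogeneous_ops F (op_cod f)"
  unfolding homogeneous_ops_def by (auto elim: op_dom_replicate)

text \<open>In a composition all argument places of \<open>g\<close> carry the codomain of
  \<open>g\<close>, so by induction every inner term lives on that same phylum and only its
  operations occur.\<close>

lemma orderly_term_homogeneous:
  assumes "f \<in> orderly_terms I F"
  shows "op_cod f \<in> I \<and> op_dom f \<noteq> [] \<and> set (op_dom f) \<subseteq> {op_cod f} \<and>
    f \<in> orderly_terms {op_cod f} (homogeneous_ops F (op_cod f))"
  using assms
proof induction
  case (basic f)
  then show ?case
    by (auto intro: orderly_terms.basic op_in_homogeneous_ops op_cod_index elim: op_dom_replicate)
next
  case (ident \<xi>)
  then show ?case by (auto intro: orderly_terms.ident)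
next
  case (comp g hs)
  obtain n where n: "op_dom g = replicate (Suc n) (op_cod g)"
    using op_dom_replicate[OF comp.hyps(1)] .
  with comp.hyps(2) have len: "length hs = Suc n"
    by (metis length_map length_replicate)
  have "set (map op_cod hs) = {op_cod g}"
    by (simp only: comp.hyps(2) n set_replicate_Suc)
  then have cod: "op_cod h = op_cod g" if "h \<in> set hs" for h
    using that by auto
  have "orderly_comp g hs \<in> orderly_terms {op_cod g} (homogeneous_ops F (op_cod g))"
    using comp cod op_in_homogeneous_ops by (intro orderly_terms.comp) auto
  moreover have "concat (map op_dom hs) \<noteq> []"
    using len comp.IH by (cases hs) auto
  moreover have "set (concat (map op_dom hs)) \<subseteq> {op_cod g}"
    using comp.IH cod by fastforce
  ultimately show ?case
    using comp.hyps(1) op_cod_index by (simp add: orderly_comp_def)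
qed

lemma orderly_term_dom:
  assumes "f \<in> orderly_terms I F"
  shows "op_dom f = replicate (length (op_dom f)) (op_cod f)"
  using orderly_term_homogeneous[OF assms] by (intro replicate_eqI) auto

lemma orderly_term_maps:
  assumes "f \<in> orderly_terms I F"
  shows "op_fun f \<in> tuples A (op_dom f) \<rightarrow> A (op_cod f)"
  using assms
proof induction
  case (basic f)
  then show ?case by (rule op_fun_maps)
next
  case (ident \<xi>)
  then show ?case by (auto simp: tuples_def list_all2_Cons2)
next
  case (comp g hs)
  have "op_fun g (apply_blocks hs xs) \<in> A (op_cod g)"
    if "xs \<in> tuples A (concat (map op_dom hs))" for xs
    using apply_blocks_tuples[OF _ that] comp op_fun_maps[of g] by auto
  then show ?case
    by (simp add: orderly_comp_def)
qed

lemma orderly_terms_homogeneous_ops_subset: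
  assumes "\<eta> \<in> I"
  shows "orderly_terms {\<eta>} (homogeneous_ops F \<eta>) \<subseteq> orderly_terms I F"
  using assms by (auto simp: homogeneous_ops_def intro: orderly_terms_mono)

lemma orderly_term_homogeneous_ops_cod:
  assumes "f \<in> orderly_terms {\<eta>} (homogeneous_ops F \<eta>)"
  shows "op_cod f = \<eta>"
  using assms by cases (auto simp: homogeneous_ops_def orderly_comp_def)

lemma phylum_index_unique:
  assumes "x \<in> A \<xi>" and "x \<in> A \<zeta>" and "\<xi> \<in> I" and "\<zeta> \<in> I"
  shows "\<xi> = \<zeta>"
  using assms phyla_disjoint unfolding disjoint_family_on_def by blast

section \<open>Block form of sorted reductions\<close>

text \<open>By disjointness of the phyla the value \<open>a j\<close> determines the codomain of
  \<open>f j\<close>. That term lives on a single phylum, so the entries of \<open>b\<close> it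
  consumes lie there too, and disjointness again fixes the sort of their positions.\<close>

lemma sorted_reduction_blocks:
  assumes "reduction I A F a b" and "sorted_by A e a" and "sorted_by A e b" and "e \<in> sorts I"
  obtains ks f where "increasing_blocks ks"
    and "\<And>j. f j \<in> orderly_terms I F" and "\<And>j. op_cod (f j) = e j"
    and "\<And>j. map b (ks j) \<in> tuples A (op_dom (f j))"
    and "\<And>j. a j = op_fun (f j) (map b (ks j))"
    and "\<And>j k. k \<in> set (ks j) \<Longrightarrow> e k = e j"
proof -
  obtain f ks where ks: "increasing_blocks ks"
    and f: "\<And>j. f j \<in> orderly_terms I F" "\<And>j. map b (ks j) \<in> tuples A (op_dom (f j))"
      "\<And>j. a j = op_fun (f j) (map b (ks j))"
    using assms(1) reduction_iff_blocks orderly_term_homogeneous by (metis (lifting))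
  have e: "e n \<in> I" for n
    using assms(4) by (auto simp: sorts_def)
  have cod: "op_cod (f j) = e j" for j
  proof (rule phylum_index_unique)
    show "a j \<in> A (op_cod (f j))"
      using orderly_term_maps[OF f(1)] f(2,3) by (metis PiE)
    show "a j \<in> A (e j)"
      using assms(2) by (simp add: sorted_by_def)
    show "op_cod (f j) \<in> I" using f(1) orderly_term_homogeneous by blast
  qed (rule e)
  have "e k = e j" if "k \<in> set (ks j)" for j k
  proof (rule phylum_index_unique)
    show "b k \<in> A (e k)"
      using assms(3) by (simp add: sorted_by_def)
    have "set (map b (ks j)) \<subseteq> A (e j)"
      using f(2)[of j] orderly_term_dom[OF f(1)[of j]] unfolding cod
      by (metis (mono_tags, lifting) mem_Collect_eq tuples_replicate)
    with that show "b k \<in> A (e j)" by auto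
  qed (rule e)+
  with ks f cod show thesis by (intro that)
qed

lemma reduction_blocksI:
  assumes "increasing_blocks ks"
    and "\<And>j. f j \<in> orderly_terms I F"
    and "\<And>j. map b (ks j) \<in> tuples A (op_dom (f j))"
    and "\<And>j. a j = op_fun (f j) (map b (ks j))"
  shows "reduction I A F a b"
  using assms reduction_iff_blocks orderly_term_homogeneous by (metis (lifting))

lemma homogeneous_reduction_iff_blocks:
  assumes "\<eta> \<in> I"
  shows "reduction {\<eta>} (\<lambda>_. A \<eta>) (homogeneous_ops F \<eta>) a b \<longleftrightarrow>
    (\<exists>f ks. increasing_blocks ks \<and>
       (\<forall>j. f j \<in> orderly_terms {\<eta>} (homogeneous_ops F \<eta>) \<and>
            map b (ks j) \<in> tuples (\<lambda>_. A \<eta>) (op_dom (f j)) \<and>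
            a j = op_fun (f j) (map b (ks j))))"
  using orderly_terms_homogeneous_ops_subset[OF assms] orderly_term_homogeneous
  by (intro reduction_iff_blocks) blast

text \<open>Passes between the constant family of phyla of the homogeneous algebra and the family
  \<open>A\<close>.\<close>

lemma tuples_homogeneous_iff:
  assumes "f \<in> orderly_terms I F"
  shows "xs \<in> tuples (\<lambda>_. A (op_cod f)) (op_dom f) \<longleftrightarrow> xs \<in> tuples A (op_dom f)"
  by (subst (1 2) orderly_term_dom[OF assms]) (simp add: tuples_replicate)

text \<open>Membership requires an entire sorted reduction, not only its first entry. Identities on
  single positions of the right sorts supply the remaining entries.\<close>

lemma FR_sortedI:
  assumes "sorted_by A e a" and "e \<in> sorts I" and "increasing_blocks ks"
    and "f \<in> orderly_terms I F" and "op_cod f = e 0" and "map a (ks 0) \<in> tuples A (op_dom f)"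
    and tail: "\<And>j. \<exists>m. ks (Suc j) = [m] \<and> e m = e (Suc j)"
  shows "op_fun f (map a (ks 0)) \<in> FR_sorted I A F e a"
proof -
  define g where "g j = (if j = 0 then f else Operation [e j] (e j) hd)" for j
  define c where "c j = op_fun (g j) (map a (ks j))" for j
  have e: "e n \<in> I" for n
    using assms(2) by (auto simp: sorts_def)
  have g: "g j \<in> orderly_terms I F" for j
    using assms(4) e by (auto simp: g_def intro: orderly_terms.ident)
  have dom: "map a (ks j) \<in> tuples A (op_dom (g j))" for j
  proof (cases j)
    case 0
    then show ?thesis using assms(6) by (simp add: g_def)
  next
    case (Suc i)
    obtain m where "ks (Suc i) = [m]" "e m = e (Suc i)"
      using tail by blast
    then show ?thesis
      using assms(1) by (auto simp: Suc g_def tuples_def sorted_by_def dest: spec[of _ m])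
  qed
  have "reduction I A F c a"
    using assms(3) g dom c_def by (rule reduction_blocksI)
  moreover have "c j \<in> A (e j)" for j
  proof -
    have "op_cod (g j) = e j"
      using assms(5) by (simp add: g_def)
    with orderly_term_maps[OF g[of j]] dom[of j] show ?thesis
      by (auto simp: c_def)
  qed
  ultimately have "c 0 \<in> FR_sorted I A F e a"
    by (auto simp: FR_sorted_def sorted_by_def)
  then show ?thesis by (simp add: c_def g_def)
qed

end

section \<open>Sorts in which every index recurs\<close>

text \<open>Dependent choice: the next block is taken beyond the last position of the previous one.
  The first block can be prescribed.\<close>

lemma increasing_blocks_choice:
  assumes "\<forall>j l. P j l \<longrightarrow> l \<noteq> [] \<and> sorted_wrt (<) l"
    and "P 0 l\<^sub>0" and "\<And>j n. \<exists>l. P (Suc j) l \<and> n < hd l"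
  shows "\<exists>ks. increasing_blocks ks \<and> (\<forall>j. P j (ks j)) \<and> ks 0 = l\<^sub>0"
proof -
  have "\<exists>ks. \<forall>j. (P j (ks j) \<and> (j = 0 \<longrightarrow> ks j = l\<^sub>0)) \<and> last (ks j) < hd (ks (Suc j))"
    using assms(2,3) by (intro dependent_nat_choice) auto
  then obtain ks where "\<And>j. P j (ks j)" "ks 0 = l\<^sub>0" "\<And>j. last (ks j) < hd (ks (Suc j))"
    by blast
  with assms(1) show ?thesis
    unfolding increasing_blocks_def by blast
qed

lemma Omega_unbounded:
  assumes "e \<in> Omega I"
  obtains m where "n < m" and "e m = e j"
proof -
  have "infinite {m. e m = e j}"
    using assms by (simp add: Omega_def)
  then show thesis
    using that by (auto simp: infinite_nat_iff_unbounded)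
qed

context phylumwise_algebra
begin

text \<open>The positions of sort \<open>\<eta>\<close> carry a sequence in \<open>A \<eta>\<close>,
  which has a homogeneous reduction \<open>a'\<close>. A sorted reduction \<open>a\<close> of
  \<open>b\<close> is woven from a subsequence of \<open>a'\<close> at these positions and single
  entries of \<open>b\<close> at the others.\<close>

lemma Ramsey_algebra_imp_sorted_Ramsey_algebra:
  assumes "\<eta> \<in> I" and "e \<in> Omega_at I \<eta>"
    and Ramsey: "Ramsey_algebra \<eta> (A \<eta>) (homogeneous_ops F \<eta>)"
  shows "sorted_Ramsey_algebra I A F e"
  unfolding sorted_Ramsey_algebra_def
proof (intro allI impI, elim conjE)
  fix b X
  assume b: "sorted_by A e b" and X: "X \<subseteq> A (e 0)"
  have Omega: "e \<in> Omega I" and e0: "e 0 = \<eta>" and sort: "e \<in> sorts I"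
    using assms(2) by (auto simp: Omega_at_def Omega_def)
  then have e: "e n \<in> I" for n
    by (auto simp: sorts_def)
  define p where "p = enumerate {n. e n = \<eta>}"
  have inf: "infinite {n. e n = \<eta>}"
    using Omega e0 by (auto simp: Omega_def)
  then have p: "e (p n) = \<eta>" for n
    using enumerate_in_set[OF inf] by (simp add: p_def)
  have p_less: "p m < p n" if "m < n" for m n
    using inf that by (simp add: p_def enumerate_mono)
  have "range (b \<circ> p) \<subseteq> A \<eta>"
    using b p unfolding sorted_by_def by (auto, metis)
  then obtain a' where "range a' \<subseteq> A \<eta>"
    and red: "reduction {\<eta>} (\<lambda>_. A \<eta>) (homogeneous_ops F \<eta>) a' (b \<circ> p)"
    and hom: "FR \<eta> (A \<eta>) (homogeneous_ops F \<eta>) a' \<subseteq> X \<or>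
              FR \<eta> (A \<eta>) (homogeneous_ops F \<eta>) a' \<inter> X = {}"
    using Ramsey X e0 unfolding Ramsey_algebra_def by blast
  obtain f' ks' where ks': "increasing_blocks ks'"
    and f': "\<And>j. f' j \<in> orderly_terms {\<eta>} (homogeneous_ops F \<eta>)"
      "\<And>j. map (b \<circ> p) (ks' j) \<in> tuples (\<lambda>_. A \<eta>) (op_dom (f' j))"
      "\<And>j. a' j = op_fun (f' j) (map (b \<circ> p) (ks' j))"
    using red unfolding homogeneous_reduction_iff_blocks[OF assms(1)] by blast
  have f'_OT: "f' j \<in> orderly_terms I F" and f'_cod: "op_cod (f' j) = \<eta>" for j
    using f'(1) orderly_terms_homogeneous_ops_subset[OF assms(1)]
      orderly_term_homogeneous_ops_cod by blast+
  define L where "L k = map p (ks' k)" for k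
  have L: "increasing_blocks L"
    unfolding L_def using ks' p_less by (intro increasing_blocks_map) auto
  have L_dom: "map b (L k) \<in> tuples A (op_dom (f' k))"
    and a'_L: "a' k = op_fun (f' k) (map b (L k))" for k
    using f'(2,3)[of k] tuples_homogeneous_iff[OF f'_OT] by (simp_all add: L_def f'_cod)
  \<comment> \<open>At sort \<open>\<eta>\<close> the block must be one of those that compute an
    entry of \<open>a'\<close>; at any other sort a single position of that sort suffices.\<close>
  define P where "P j l = (if e j = \<eta> then \<exists>k. l = L k else \<exists>m. e m = e j \<and> l = [m])"
    for j and l :: "nat list"
  have P_ne: "\<forall>j l. P j l \<longrightarrow> l \<noteq> [] \<and> sorted_wrt (<) l"
    using L unfolding P_def increasing_blocks_def by (auto split: if_splits)
  have P_0: "P 0 (L 0)"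
    using e0 by (auto simp: P_def)
  have P_Suc: "\<exists>l. P (Suc j) l \<and> n < hd l" for j n
  proof (cases "e (Suc j) = \<eta>")
    case True
    have "hd (L (Suc n)) \<in> set (L (Suc n))"
      using L by (simp add: increasing_blocks_def)
    then have "n < hd (L (Suc n))"
      using increasing_blocks_ge_index[OF L] by fastforce
    with True show ?thesis by (auto simp: P_def)
  next
    case False
    obtain m where "n < m" "e m = e (Suc j)"
      using Omega_unbounded[OF Omega] .
    with False show ?thesis
      by (intro exI[of _ "[m]"]) (simp add: P_def)
  qed
  obtain ls where ls: "increasing_blocks ls" and P: "\<And>j. P j (ls j)"
    using increasing_blocks_choice[OF P_ne P_0 P_Suc] by blast
  \<comment> \<open>\<open>k j\<close> recovers which block of \<open>L\<close> was chosen. It is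
    meaningful only where \<open>e j = \<eta>\<close>.\<close>
  define k where "k j = (SOME k. ls j = L k)" for j
  have k: "ls j = L (k j)" if "e j = \<eta>" for j
  proof -
    have "\<exists>k. ls j = L k"
      using P[of j] that by (simp add: P_def)
    then show ?thesis
      unfolding k_def by (rule someI_ex)
  qed
  \<comment> \<open>Otherwise the later block of \<open>ls\<close> would coincide with or precede
    the earlier one, since the blocks of \<open>L\<close> are themselves ordered.\<close>
  have k_less: "k i < k j" if "i < j" "e i = \<eta>" "e j = \<eta>" for i j
  proof (rule ccontr)
    assume "\<not> k i < k j"
    have "hd (ls i) \<in> set (ls i)" "hd (ls j) \<in> set (ls j)"
      using ls by (simp_all add: increasing_blocks_def)
    moreover from this have "hd (ls i) < hd (ls j)"
      using increasing_blocks_less[OF ls that(1)] by blast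
    ultimately show False
      using k that(2,3) \<open>\<not> k i < k j\<close> increasing_blocks_less[OF L, of "k j" "k i"]
      by (metis less_asym less_irrefl linorder_neqE_nat)
  qed
  define f where "f j = (if e j = \<eta> then f' (k j) else Operation [e j] (e j) hd)" for j
  define a where "a j = op_fun (f j) (map b (ls j))" for j
  have f: "f j \<in> orderly_terms I F" for j
    using f'_OT e by (auto simp: f_def intro: orderly_terms.ident)
  have f_dom: "map b (ls j) \<in> tuples A (op_dom (f j))" for j
  proof (cases "e j = \<eta>")
    case True
    then show ?thesis using L_dom k by (simp add: f_def)
  next
    case False
    then obtain m where "e m = e j" "ls j = [m]"
      using P[of j] by (auto simp: P_def)
    with False b show ?thesis
      unfolding f_def tuples_def sorted_by_def by (simp, metis)
  qed
  have "reduction I A F a b"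
    using ls f f_dom a_def by (rule reduction_blocksI)
  moreover have a: "sorted_by A e a"
    unfolding sorted_by_def
  proof
    fix j
    have "op_cod (f j) = e j"
      by (simp add: f_def f'_cod)
    then show "a j \<in> A (e j)"
      using orderly_term_maps[OF f[of j]] f_dom[of j] by (auto simp: a_def)
  qed
  \<comment> \<open>A first entry of sort \<open>\<eta>\<close> reads \<open>a\<close> only at
    positions of sort \<open>\<eta>\<close>, where \<open>a\<close> agrees with \<open>a'\<close>
    composed with the increasing \<open>k\<close>.\<close>
  moreover have "FR_sorted I A F e a \<subseteq> FR \<eta> (A \<eta>) (homogeneous_ops F \<eta>) a'"
  proof
    fix x assume "x \<in> FR_sorted I A F e a"
    then obtain c where c: "x = c 0" "reduction I A F c a" "sorted_by A e c"
      by (auto simp: FR_sorted_def)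
    obtain ms g where ms: "increasing_blocks ms"
      and gs: "\<And>j. g j \<in> orderly_terms I F" "\<And>j. op_cod (g j) = e j"
        "\<And>j. map a (ms j) \<in> tuples A (op_dom (g j))"
        "\<And>j. c j = op_fun (g j) (map a (ms j))"
      and ms_sort: "\<And>j n. n \<in> set (ms j) \<Longrightarrow> e n = e j"
      by (rule sorted_reduction_blocks[OF c(2,3) a sort]) (rule that; blast)
    note g = gs(1-3)[of 0]
    have x: "x = op_fun (g 0) (map a (ms 0))"
      using c(1) gs(4) by simp
    have "a n = a' (k n)" if "n \<in> set (ms 0)" for n
      using ms_sort[OF that] k[of n] a'_L by (simp add: a_def f_def e0)
    then have a_a': "map a (ms 0) = map a' (map k (ms 0))"
      by simp
    have "sorted_wrt (<) (ms 0)"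
      using ms by (simp add: increasing_blocks_def)
    then have "sorted_wrt (<) (map k (ms 0))"
      unfolding sorted_wrt_map
      by (rule sorted_wrt_mono_rel[rotated]) (use ms_sort k_less e0 in simp)
    moreover have "g 0 \<in> orderly_terms {\<eta>} (homogeneous_ops F \<eta>)"
      using orderly_term_homogeneous[OF g(1)] g(2) e0 by simp
    moreover have "map a' (map k (ms 0)) \<in> tuples (\<lambda>_. A \<eta>) (op_dom (g 0))"
      using tuples_homogeneous_iff[OF g(1)] g(2,3) e0 a_a' by simp
    ultimately show "x \<in> FR \<eta> (A \<eta>) (homogeneous_ops F \<eta>) a'"
      unfolding FR_def x a_a' by blast
  qed
  ultimately show "\<exists>a. sorted_by A e a \<and> reduction I A F a b \<and>
      (FR_sorted I A F e a \<subseteq> X \<or> FR_sorted I A F e a \<inter> X = {})"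
    using hom by blast
qed

text \<open>A sequence in \<open>A \<eta>\<close> is spread over the positions of sort
  \<open>\<eta>\<close> and padded elsewhere. A homogeneous sorted reduction of the result,
  restricted to these positions, reduces the original sequence.\<close>

lemma sorted_Ramsey_algebra_imp_Ramsey_algebra:
  assumes "\<eta> \<in> I" and "e \<in> Omega_at I \<eta>"
    and Ramsey: "sorted_Ramsey_algebra I A F e"
  shows "Ramsey_algebra \<eta> (A \<eta>) (homogeneous_ops F \<eta>)"
  unfolding Ramsey_algebra_def
proof (intro allI impI, elim conjE)
  fix b :: "nat \<Rightarrow> 'a" and X
  assume b: "range b \<subseteq> A \<eta>" and X: "X \<subseteq> A \<eta>"
  have Omega: "e \<in> Omega I" and e0: "e 0 = \<eta>" and sort: "e \<in> sorts I"
    using assms(2) by (auto simp: Omega_at_def Omega_def)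
  then have e: "e n \<in> I" for n
    by (auto simp: sorts_def)
  define E where "E = {n. e n = \<eta>}"
  define p where "p = enumerate E"
  have inf: "infinite E"
    using Omega e0 by (auto simp: Omega_def E_def)
  then have p: "e (p n) = \<eta>" for n
    using enumerate_in_set[OF inf] by (simp add: p_def E_def)
  have p_less: "p m < p n \<longleftrightarrow> m < n" for m n
    using inf by (simp add: p_def)
  then have "strict_mono p" by (simp add: strict_mono_def)
  then have inv_p: "inv p (p n) = n" for n
    by (simp add: strict_mono_imp_inj_on)
  have range_p: "range p = E"
    using range_enumerate[OF inf] by (simp add: p_def)
  then have p_inv: "p (inv p n) = n" if "e n = \<eta>" for n
    using that by (intro f_inv_into_f) (simp add: E_def)
  \<comment> \<open>\<open>inv p\<close> numbers the positions of sort \<open>\<eta>\<close>. The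
    other values are arbitrary elements of the required nonempty phyla.\<close>
  define b' where "b' n = (if e n = \<eta> then b (inv p n) else SOME x. x \<in> A (e n))" for n
  have "b' n \<in> A (e n)" for n
    using b phylum_nonempty[OF e[of n]] by (auto simp: b'_def some_in_eq)
  then have b': "sorted_by A e b'" by (simp add: sorted_by_def)
  with Ramsey X e0 obtain a where a: "sorted_by A e a" and red: "reduction I A F a b'"
    and hom: "FR_sorted I A F e a \<subseteq> X \<or> FR_sorted I A F e a \<inter> X = {}"
    unfolding sorted_Ramsey_algebra_def by blast
  obtain ks f where ks: "increasing_blocks ks"
    and f: "\<And>j. f j \<in> orderly_terms I F" "\<And>j. op_cod (f j) = e j"
      "\<And>j. map b' (ks j) \<in> tuples A (op_dom (f j))"
      "\<And>j. a j = op_fun (f j) (map b' (ks j))"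
    and ks_sort: "\<And>j k. k \<in> set (ks j) \<Longrightarrow> e k = e j"
    by (rule sorted_reduction_blocks[OF red a b' sort]) (rule that; blast)
  have "increasing_blocks (\<lambda>j. ks (p j))"
    unfolding increasing_blocks_def
  proof (intro allI conjI)
    fix j
    show "ks (p j) \<noteq> []" "sorted_wrt (<) (ks (p j))"
      using ks by (auto simp: increasing_blocks_def)
    show "last (ks (p j)) < hd (ks (p (Suc j)))"
      by (rule increasing_blocks_less[OF ks, of "p j" "p (Suc j)"])
        (use ks in \<open>auto simp: increasing_blocks_def p_less\<close>)
  qed
  then have blocks: "increasing_blocks (\<lambda>j. map (inv p) (ks (p j)))"
  proof (rule increasing_blocks_map)
    fix i j x y
    assume "x \<in> set (ks (p i))" "y \<in> set (ks (p j))" "x < y"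
    then have "p (inv p x) < p (inv p y)"
      using p_inv ks_sort p by metis
    then show "inv p x < inv p y" by (simp add: p_less)
  qed
  have OT: "f (p j) \<in> orderly_terms {\<eta>} (homogeneous_ops F \<eta>)" for j
    using orderly_term_homogeneous[OF f(1)] f(2) p by metis
  have b_b': "map b (map (inv p) (ks (p j))) = map b' (ks (p j))" for j
    using ks_sort p by (simp add: b'_def)
  have "reduction {\<eta>} (\<lambda>_. A \<eta>) (homogeneous_ops F \<eta>) (a \<circ> p) b"
    unfolding homogeneous_reduction_iff_blocks[OF assms(1)]
    using blocks OT tuples_homogeneous_iff[OF f(1)] f(2-4) p b_b'
    by (intro exI[of _ "f \<circ> p"] exI[of _ "\<lambda>j. map (inv p) (ks (p j))"]) (metis o_apply)
  moreover have a_p: "range (a \<circ> p) \<subseteq> A \<eta>"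
    using a p unfolding sorted_by_def by (auto, metis)
  \<comment> \<open>Any value over \<open>a \<circ> p\<close> can open a sorted reduction of
    \<open>a\<close>: since every index recurs, identities further out provide the later
    entries.\<close>
  moreover have "FR \<eta> (A \<eta>) (homogeneous_ops F \<eta>) (a \<circ> p) \<subseteq> FR_sorted I A F e a"
  proof
    fix x assume "x \<in> FR \<eta> (A \<eta>) (homogeneous_ops F \<eta>) (a \<circ> p)"
    then obtain g ms where g: "g \<in> orderly_terms {\<eta>} (homogeneous_ops F \<eta>)"
      and ms: "sorted_wrt (<) ms" and dom: "map (a \<circ> p) ms \<in> tuples (\<lambda>_. A \<eta>) (op_dom g)"
      and x: "x = op_fun g (map (a \<circ> p) ms)"
      unfolding FR_def by blast
    have g_OT: "g \<in> orderly_terms I F" and g_cod: "op_cod g = \<eta>"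
      using g orderly_terms_homogeneous_ops_subset[OF assms(1)]
        orderly_term_homogeneous_ops_cod by blast+
    define P where "P j l = (if j = 0 then l = map p ms else \<exists>m. l = [m] \<and> e m = e j)"
      for j :: nat and l :: "nat list"
    have "ms \<noteq> []"
      using orderly_term_homogeneous[OF g_OT] length_tuples[OF dom] by auto
    moreover have "sorted_wrt (<) (map p ms)"
      using ms by (simp add: sorted_wrt_map p_less)
    ultimately have P_ne: "\<forall>j l. P j l \<longrightarrow> l \<noteq> [] \<and> sorted_wrt (<) l"
      by (auto simp: P_def)
    have P_0: "P 0 (map p ms)"
      by (simp add: P_def)
    have P_Suc: "\<exists>l. P (Suc j) l \<and> n < hd l" for j n
    proof -
      obtain m where "n < m" "e m = e (Suc j)"
        using Omega_unbounded[OF Omega] .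
      then show ?thesis
        by (intro exI[of _ "[m]"]) (simp add: P_def)
    qed
    obtain ls where ls: "increasing_blocks ls" "\<And>j. P j (ls j)" "ls 0 = map p ms"
      using increasing_blocks_choice[OF P_ne P_0 P_Suc] by blast
    have "\<exists>m. ls (Suc j) = [m] \<and> e m = e (Suc j)" for j
      using ls(2)[of "Suc j"] by (simp add: P_def)
    moreover have "map a (ls 0) \<in> tuples A (op_dom g)"
      using dom tuples_homogeneous_iff[OF g_OT] by (simp add: g_cod ls(3))
    ultimately have "op_fun g (map a (ls 0)) \<in> FR_sorted I A F e a"
      using g_cod e0 by (intro FR_sortedI a sort ls(1) g_OT) simp_all
    then show "x \<in> FR_sorted I A F e a"
      by (simp add: x ls(3))
  qed
  ultimately show "\<exists>a. range a \<subseteq> A \<eta> \<and>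
      reduction {\<eta>} (\<lambda>_. A \<eta>) (homogeneous_ops F \<eta>) a b \<and>
      (FR \<eta> (A \<eta>) (homogeneous_ops F \<eta>) a \<subseteq> X \<or> FR \<eta> (A \<eta>) (homogeneous_ops F \<eta>) a \<inter> X = {})"
    using hom by blast
qed

end

section \<open>Sorts in which some index stops occurring\<close>

text \<open>If some value recurs infinitely often, its singleton works, because the orbit leaves it
  at the next step. If none does, the orbit is injective and can be coloured by the parity of the
  step.\<close>

lemma funpow_value_bipartition:
  fixes f :: "'a \<Rightarrow> 'a"
  assumes "\<And>n. f ((f ^^ n) r) \<noteq> (f ^^ n) r"
  obtains Y where "infinite {n. (f ^^ n) r \<in> Y}" and "infinite {n. (f ^^ n) r \<notin> Y}"
proof (cases "\<exists>v. infinite {n. (f ^^ n) r = v}")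
  case True
  then obtain v where inf: "infinite {n. (f ^^ n) r = v}" by blast
  have "Suc ` {n. (f ^^ n) r = v} \<subseteq> {n. (f ^^ n) r \<notin> {v}}"
    using assms by auto
  with inf have "infinite {n. (f ^^ n) r \<notin> {v}}"
    by (meson finite_imageD finite_subset inj_Suc)
  with inf that[of "{v}"] show thesis by simp
next
  case False
  have inj: "inj (\<lambda>n. (f ^^ n) r)"
  proof (rule linorder_injI)
    fix m n :: nat
    assume "m < n"
    show "(f ^^ m) r \<noteq> (f ^^ n) r"
    proof
      assume eq: "(f ^^ m) r = (f ^^ n) r"
      \<comment> \<open>One repetition makes the orbit periodic from \<open>m\<close> on, so a value
        would recur infinitely often.\<close>
      have "(f ^^ (m + i * (n - m))) r = (f ^^ m) r" for i
      proof (induction i)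
        case (Suc i)
        have "(f ^^ (m + Suc i * (n - m))) r = (f ^^ (n - m)) ((f ^^ (m + i * (n - m))) r)"
          by (simp flip: comp_apply[of "f ^^ _"] funpow_add add: ac_simps)
        also have "\<dots> = (f ^^ (n - m + m)) r"
          unfolding Suc.IH by (simp add: funpow_add)
        finally show ?case using eq \<open>m < n\<close> by simp
      qed simp
      then have "range (\<lambda>i. m + i * (n - m)) \<subseteq> {i. (f ^^ i) r = (f ^^ m) r}"
        by auto
      moreover have "inj (\<lambda>i. m + i * (n - m))"
        using \<open>m < n\<close> by (intro injI) simp
      then have "infinite (range (\<lambda>i. m + i * (n - m)))"
        by (rule range_inj_infinite)
      ultimately show False
        using False finite_subset by blast
    qed
  qed
  define Y where "Y = (\<lambda>n. (f ^^ (2 * n)) r) ` UNIV"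
  have Y: "(f ^^ n) r \<in> Y \<longleftrightarrow> even n" for n
    using inj_eq[OF inj] by (auto simp: Y_def elim!: evenE)
  have "infinite {n :: nat. even n}" "infinite {n :: nat. odd n}"
    unfolding infinite_nat_iff_unbounded
    by (auto, metis even_Suc lessI less_SucI, metis even_Suc lessI less_SucI)
  with that[of Y] show thesis by (simp add: Y)
qed

text \<open>
  Two points are in the same component if their forward orbits meet. A colouring that alternates
  infinitely often along the orbit of one representative per component works for all its points,
  since every orbit eventually runs along the representative's orbit.
\<close>

lemma funpow_bipartition:
  fixes f :: "'a \<Rightarrow> 'a"
  obtains X where "\<And>x. (\<And>n. f ((f ^^ n) x) \<noteq> (f ^^ n) x) \<Longrightarrow>
    (\<exists>n. (f ^^ n) x \<in> X) \<and> (\<exists>n. (f ^^ n) x \<notin> X)"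
proof -
  define R where "R x y \<longleftrightarrow> (\<exists>m n. (f ^^ m) x = (f ^^ n) y)" for x y
  have "R x x" for x
    unfolding R_def by blast
  have R_sym: "R x y \<Longrightarrow> R y x" for x y
    unfolding R_def by metis
  have R_trans: "R x z" if xy: "R x y" and yz: "R y z" for x y z
  proof -
    obtain k l m n where "(f ^^ k) x = (f ^^ l) y" "(f ^^ m) y = (f ^^ n) z"
      using xy yz unfolding R_def by blast
    then have "(f ^^ (m + k)) x = (f ^^ (l + n)) z"
      by (metis add.commute comp_apply funpow_add)
    then show ?thesis unfolding R_def by blast
  qed
  \<comment> \<open>Related points have equal predicates \<open>R x\<close>, so the choice depends
    only on the component.\<close>
  define rep where "rep x = (SOME y. R x y)" for x
  have rep: "R x (rep x)" for x
    unfolding rep_def using \<open>R x x\<close> by (rule someI)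
  have rep_eq: "rep x = rep y" if "R x y" for x y
  proof -
    have "R x = R y"
      using that R_sym R_trans by blast
    then show ?thesis by (simp add: rep_def)
  qed
  have rep_funpow: "rep ((f ^^ n) x) = rep x" for n x
    by (rule rep_eq, unfold R_def, rule exI[of _ 0], rule exI[of _ n]) simp
  define good where
    "good r Y \<longleftrightarrow> infinite {n. (f ^^ n) r \<in> Y} \<and> infinite {n. (f ^^ n) r \<notin> Y}" for r Y
  \<comment> \<open>A proper choice only if some \<open>good r Y\<close> exists; for other
    \<open>r\<close> the set is arbitrary.\<close>
  define Y where "Y r = (SOME Y. good r Y)" for r
  define X where "X = {x. x \<in> Y (rep x)}"
  have "(\<exists>n. (f ^^ n) x \<in> X) \<and> (\<exists>n. (f ^^ n) x \<notin> X)"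
    if no_fix: "\<And>n. f ((f ^^ n) x) \<noteq> (f ^^ n) x" for x
  proof -
    obtain m n where mn: "(f ^^ m) x = (f ^^ n) (rep x)"
      using rep[of x] unfolding R_def by blast
    have shift: "(f ^^ (m + i)) x = (f ^^ (n + i)) (rep x)" for i
      using mn by (metis add.commute comp_apply funpow_add)
    \<comment> \<open>The orbit of \<open>x\<close> merges into that of \<open>rep x\<close>, so a
      fixed point on the latter would be reached from \<open>x\<close>.\<close>
    have "f ((f ^^ i) (rep x)) \<noteq> (f ^^ i) (rep x)" for i
    proof
      assume fix_i: "f ((f ^^ i) (rep x)) = (f ^^ i) (rep x)"
      then have "(f ^^ (j + i)) (rep x) = (f ^^ i) (rep x)" for j
        by (induction j) simp_all
      from this[of n] this[of "Suc n"] have "f ((f ^^ (n + i)) (rep x)) = (f ^^ (n + i)) (rep x)"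
        using fix_i by simp
      with no_fix[of "m + i"] show False by (simp add: shift)
    qed
    then have "\<exists>Y. good (rep x) Y"
      using funpow_value_bipartition[of f "rep x"] unfolding good_def by metis
    then have good: "good (rep x) (Y (rep x))"
      unfolding Y_def by (rule someI_ex)
    \<comment> \<open>The orbit of \<open>x\<close> may miss the first \<open>n\<close> steps of the
      representative's orbit; infinitely many occurrences guarantee one beyond them.\<close>
    have hit: "\<exists>i. P ((f ^^ i) x)" if "infinite {i. P ((f ^^ i) (rep x))}" for P
    proof -
      obtain i where "n < i" "P ((f ^^ i) (rep x))"
        using \<open>infinite _\<close> by (auto simp: infinite_nat_iff_unbounded)
      with shift[of "i - n"] show ?thesis
        by (intro exI[of _ "m + (i - n)"]) simp
    qed
    show ?thesis
      using hit[of "\<lambda>z. z \<in> Y (rep x)"] hit[of "\<lambda>z. z \<notin> Y (rep x)"] good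
      unfolding good_def X_def by (simp add: rep_funpow)
  qed
  then show thesis by (rule that)
qed

section \<open>Unary terms and the reduction to fixed points\<close>

context phylumwise_algebra
begin

text \<open>Every inner term consumes at least one argument, so a unary composition has exactly one
  inner term, which is again unary. The outer operation goes last in the list because
  \<open>fold\<close> applies the head first.\<close>

lemma unary_orderly_term_iterate:
  assumes "f \<in> orderly_terms I F" and "length (op_dom f) = 1"
  shows "\<exists>fs. set fs \<subseteq> unary_ops (homogeneous_ops F (op_cod f)) \<and>
           (\<forall>x. op_fun f [x] = unary_iterate fs x)"
  using assms
proof induction
  case (basic f)
  then show ?case
    by (intro exI[of _ "[f]"]) (simp add: unary_ops_def op_in_homogeneous_ops)
next
  case (ident \<xi>)
  show ?case by (rule exI[of _ "[]"]) simp
next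
  case (comp g hs)
  have OT: "\<forall>h\<in>set hs. h \<in> orderly_terms I F"
    using comp.IH by blast
  have "hs \<noteq> []"
    using op_dom_nonempty[OF comp.hyps(1)] comp.hyps(2) by auto
  then obtain h hs' where hs: "hs = h # hs'"
    by (cases hs) auto
  have "op_dom h' \<noteq> []" if "h' \<in> set hs" for h'
    using OT that orderly_term_homogeneous by blast
  then have len: "length (op_dom h) = 1" and "hs' = []"
    using comp.prems hs by (cases hs'; cases "op_dom h"; fastforce simp: orderly_comp_def)+
  then have dom_g: "op_dom g = [op_cod h]"
    using comp.hyps(2) hs by simp
  then have "op_cod h = op_cod g"
    using op_dom_replicate[OF comp.hyps(1)] by (metis list.inject replicate_Suc)
  then obtain fs where "set fs \<subseteq> unary_ops (homogeneous_ops F (op_cod g))"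
    "\<And>x. op_fun h [x] = unary_iterate fs x"
    using comp.IH len hs by auto
  then show ?case
    using comp.hyps(1) dom_g len \<open>hs' = []\<close> hs
    by (intro exI[of _ "fs @ [g]"])
      (simp add: orderly_comp_def unary_ops_def op_in_homogeneous_ops)
qed

text \<open>The induction peels off the last operation: it is the outermost one, and a composition
  needs its outermost operation in \<open>F\<close>.\<close>

lemma unary_iterate_orderly_term:
  assumes "\<eta> \<in> I" and "set fs \<subseteq> unary_ops (homogeneous_ops F \<eta>)"
  shows "\<exists>f\<in>orderly_terms I F. op_dom f = [\<eta>] \<and> op_cod f = \<eta> \<and>
           (\<forall>x. op_fun f [x] = unary_iterate fs x)"
  using assms(2)
proof (induction fs rule: rev_induct)
  case Nil
  then show ?case
    using assms(1) by (intro bexI[OF _ orderly_terms.ident[of \<eta>]]) simp_all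
next
  case (snoc g fs)
  then obtain h where h: "h \<in> orderly_terms I F" "op_dom h = [\<eta>]" "op_cod h = \<eta>"
    "\<And>x. op_fun h [x] = unary_iterate fs x"
    by auto
  have g: "g \<in> F" "op_dom g = [\<eta>]" "op_cod g = \<eta>"
    using snoc.prems by (auto simp: unary_ops_def homogeneous_ops_def)
  then have "orderly_comp g [h] \<in> orderly_terms I F"
    using h by (intro orderly_terms.comp) auto
  then show ?case
    using g h by (intro bexI[of _ "orderly_comp g [h]"]) (simp_all add: orderly_comp_def)
qed

lemma unary_iterate_closed:
  assumes "x \<in> A \<eta>" and "set fs \<subseteq> unary_ops (homogeneous_ops F \<eta>)"
  shows "unary_iterate fs x \<in> A \<eta>"
  using assms
proof (induction fs arbitrary: x)
  case (Cons f fs)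
  then have "f \<in> F" "op_dom f = [\<eta>]" "op_cod f = \<eta>"
    by (auto simp: unary_ops_def homogeneous_ops_def)
  with op_fun_maps[of f] Cons.prems have "op_fun f [x] \<in> A \<eta>"
    by (auto simp: tuples_def)
  with Cons show ?case by simp
qed simp

text \<open>
  If \<open>N\<close> is the last position of an index \<open>\<xi>\<close>, block \<open>N\<close> consists of positions of sort \<open>\<xi>\<close> that
  are at least \<open>N\<close>, hence is \<open>[N]\<close>; the \<open>N\<close> nonempty blocks before it then fill \<open>0, \<dots>, N - 1\<close>.
\<close>

lemma FR_sorted_not_Omega:
  assumes a: "sorted_by A e a" and sort: "e \<in> sorts I" and "e \<notin> Omega I"
  shows "FR_sorted I A F e a =
    {unary_iterate fs (a 0) | fs. set fs \<subseteq> unary_ops (homogeneous_ops F (e 0))}"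
    (is "_ = ?R")
proof
  obtain i where fin: "finite {n. e n = e i}"
    using assms(2,3) by (auto simp: Omega_def)
  define N where "N = Max {n. e n = e i}"
  have "N \<in> {n. e n = e i}"
    unfolding N_def using fin by (intro Max_in) auto
  then have e_N: "e N = e i" by simp
  have N_max: "n \<le> N" if "e n = e N" for n
    unfolding N_def using fin that e_N by (intro Max_ge) auto
  show "FR_sorted I A F e a \<subseteq> ?R"
  proof
    fix x assume "x \<in> FR_sorted I A F e a"
    then obtain c where c: "x = c 0" "reduction I A F c a" "sorted_by A e c"
      by (auto simp: FR_sorted_def)
    obtain ks f where ks: "increasing_blocks ks"
      and fs: "\<And>j. f j \<in> orderly_terms I F" "\<And>j. op_cod (f j) = e j"
        "\<And>j. map a (ks j) \<in> tuples A (op_dom (f j))"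
        "\<And>j. c j = op_fun (f j) (map a (ks j))"
      and ks_sort: "\<And>j k. k \<in> set (ks j) \<Longrightarrow> e k = e j"
      by (rule sorted_reduction_blocks[OF c(2,3) a sort]) (rule that; blast)
    note f = fs(1-3)[of 0]
    have x: "x = op_fun (f 0) (map a (ks 0))"
      using c(1) fs(4) by simp
    have ne: "ks j \<noteq> []" "sorted_wrt (<) (ks j)" for j
      using ks by (auto simp: increasing_blocks_def)
    have "hd (ks N) \<in> set (ks N)" using ne by simp
    then have hd_N: "hd (ks N) \<le> N"
      using N_max ks_sort by blast
    have zero: "z = 0" if "z \<in> set (ks 0)" for z
    proof (cases "N = 0")
      case True
      then show ?thesis using N_max ks_sort that by fastforce
    next
      \<comment> \<open>Here \<open>z + N \<le> hd (ks N) \<le> N\<close>, which leaves only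
        0.\<close>
      case False
      then show ?thesis
        using increasing_blocks_gap[OF ks that, of "hd (ks N)" N] ne hd_N by simp
    qed
    then have "ks 0 = [0]"
      using ne[of 0] by (cases "ks 0"; cases "tl (ks 0)") (force split: list.splits)+
    with f x show "x \<in> ?R"
      using unary_orderly_term_iterate[OF f(1)] length_tuples[OF f(3)] by auto
  qed
  show "?R \<subseteq> FR_sorted I A F e a"
  proof
    fix x assume "x \<in> ?R"
    then obtain fs where fs: "set fs \<subseteq> unary_ops (homogeneous_ops F (e 0))"
      and x: "x = unary_iterate fs (a 0)" by blast
    have "e 0 \<in> I" using sort by (auto simp: sorts_def)
    then obtain f where f: "f \<in> orderly_terms I F" "op_dom f = [e 0]" "op_cod f = e 0"
      "op_fun f [a 0] = x"
      using unary_iterate_orderly_term[OF _ fs] x by metis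
    have "op_fun f (map a [0]) \<in> FR_sorted I A F e a"
      \<comment> \<open>The blocks \<open>[j]\<close> leave every position in place: the unary term
        acts on the first entry and the rest is unchanged.\<close>
      using a f by (intro FR_sortedI[of e a "\<lambda>j. [j]"] sort)
        (auto simp: increasing_blocks_def tuples_def sorted_by_def)
    then show "x \<in> FR_sorted I A F e a"
      by (simp add: f)
  qed
qed

text \<open>Reductions change the first entry only by unary operations. Once it is a common fixed
  point, the set of attainable values is a singleton. If \<open>c\<close> never reaches one, every
  point reachable from \<open>c\<close> can be moved, and a two-colouring of the resulting orbits
  defeats homogeneity.\<close>

lemma sorted_Ramsey_algebra_not_Omega_iff:
  assumes sort: "e \<in> sorts I" and not_Omega: "e \<notin> Omega I"
  shows "sorted_Ramsey_algebra I A F e \<longleftrightarrow>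
    (\<forall>c\<in>A (e 0). \<exists>fs. set fs \<subseteq> unary_ops (homogeneous_ops F (e 0)) \<and>
       unary_iterate fs c \<in> fixed_points A F (e 0))"
    (is "_ \<longleftrightarrow> ?fix")
proof
  let ?U = "unary_ops (homogeneous_ops F (e 0))"
  show "sorted_Ramsey_algebra I A F e" if ?fix
    unfolding sorted_Ramsey_algebra_def
  proof (intro allI impI, elim conjE)
    fix b X
    assume b: "sorted_by A e b" and X: "X \<subseteq> A (e 0)"
    then have "b 0 \<in> A (e 0)" by (simp add: sorted_by_def)
    with \<open>?fix\<close> obtain fs where fs: "set fs \<subseteq> ?U" "unary_iterate fs (b 0) \<in> fixed_points A F (e 0)"
      by blast
    \<comment> \<open>Membership in this set supplies the entire sorted reduction that starts with
      the fixed point.\<close>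
    then have "unary_iterate fs (b 0) \<in> FR_sorted I A F e b"
      unfolding FR_sorted_not_Omega[OF b assms] by blast
    then obtain a where a: "reduction I A F a b" "sorted_by A e a"
      and fp: "a 0 \<in> fixed_points A F (e 0)"
      using fs(2) by (auto simp: FR_sorted_def)
    have "unary_iterate gs (a 0) = a 0" if "set gs \<subseteq> ?U" for gs
      using that fp by (induction gs) (auto simp: fixed_points_def)
    then have "FR_sorted I A F e a \<subseteq> {a 0}"
      unfolding FR_sorted_not_Omega[OF a(2) assms] by auto
    with a show "\<exists>a. sorted_by A e a \<and> reduction I A F a b \<and>
        (FR_sorted I A F e a \<subseteq> X \<or> FR_sorted I A F e a \<inter> X = {})"
      by blast
  qed
  show ?fix if Ramsey: "sorted_Ramsey_algebra I A F e"
  proof (rule ccontr)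
    assume "\<not> ?fix"
    then obtain c where c: "c \<in> A (e 0)"
      and no_fix: "\<And>fs. set fs \<subseteq> ?U \<Longrightarrow> unary_iterate fs c \<notin> fixed_points A F (e 0)"
      by blast
    \<comment> \<open>At each point reachable from \<open>c\<close> this picks an operation moving
      it; elsewhere the choice is arbitrary.\<close>
    define h where "h x = (SOME g. g \<in> ?U \<and> op_fun g [x] \<noteq> x)" for x
    define \<phi> where "\<phi> x = op_fun (h x) [x]" for x
    have h: "h x \<in> ?U \<and> \<phi> x \<noteq> x" if "x = unary_iterate fs c" "set fs \<subseteq> ?U" for x fs
    proof -
      have "\<exists>g. g \<in> ?U \<and> op_fun g [x] \<noteq> x"
        using no_fix[OF that(2)] unary_iterate_closed[OF c that(2)] that(1)
        by (auto simp: fixed_points_def)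
      then show ?thesis
        unfolding \<phi>_def h_def by (rule someI_ex)
    qed
    \<comment> \<open>Although \<open>\<phi>\<close> changes its operation from point to point, each
      of its iterates on a reachable point is a composite of unary operations.\<close>
    have orbit: "\<exists>gs. set gs \<subseteq> ?U \<and> (\<phi> ^^ n) (unary_iterate fs c) = unary_iterate gs (unary_iterate fs c)"
      if fs: "set fs \<subseteq> ?U" for fs n
    proof (induction n)
      case 0
      show ?case by (intro exI[of _ "[]"]) simp
    next
      case (Suc n)
      then obtain gs where gs: "set gs \<subseteq> ?U"
        "(\<phi> ^^ n) (unary_iterate fs c) = unary_iterate gs (unary_iterate fs c)" by blast
      then have "h ((\<phi> ^^ n) (unary_iterate fs c)) \<in> ?U"
        using fs h[of _ "fs @ gs"] by simp
      with gs show ?case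
        by (intro exI[of _ "gs @ [h ((\<phi> ^^ n) (unary_iterate fs c))]"])
          (simp add: \<phi>_def[of "unary_iterate gs _"])
    qed
    obtain X where X: "\<And>x. (\<And>n. \<phi> ((\<phi> ^^ n) x) \<noteq> (\<phi> ^^ n) x) \<Longrightarrow>
        (\<exists>n. (\<phi> ^^ n) x \<in> X) \<and> (\<exists>n. (\<phi> ^^ n) x \<notin> X)"
      using funpow_bipartition[of \<phi>] by blast
    \<comment> \<open>Starting with \<open>c\<close> ensures that the first entry of every sorted
      reduction is reachable from \<open>c\<close>.\<close>
    define b where "b n = (if n = 0 then c else SOME x. x \<in> A (e n))" for n
    have "e n \<in> I" for n
      using sort by (auto simp: sorts_def)
    then have b: "sorted_by A e b"
      using c phylum_nonempty by (simp add: sorted_by_def b_def some_in_eq)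
    \<comment> \<open>The colouring lives on the whole type, so it is cut down to the phylum
      \<open>A (e 0)\<close>.\<close>
    then obtain a where a: "sorted_by A e a" "reduction I A F a b"
      and hom: "FR_sorted I A F e a \<subseteq> X \<inter> A (e 0) \<or> FR_sorted I A F e a \<inter> (X \<inter> A (e 0)) = {}"
      using Ramsey unfolding sorted_Ramsey_algebra_def by (meson inf_le2)
    have "a 0 \<in> FR_sorted I A F e b"
      using a by (auto simp: FR_sorted_def)
    then obtain fs where fs: "set fs \<subseteq> ?U" "a 0 = unary_iterate fs c"
      unfolding FR_sorted_not_Omega[OF b assms] by (auto simp: b_def)
    have FR: "(\<phi> ^^ n) (a 0) \<in> FR_sorted I A F e a" for n
      unfolding FR_sorted_not_Omega[OF a(1) assms] fs(2) using orbit[OF fs(1)] by blast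
    have "\<phi> ((\<phi> ^^ n) (a 0)) \<noteq> (\<phi> ^^ n) (a 0)" for n
    proof -
      obtain gs where "set gs \<subseteq> ?U" "(\<phi> ^^ n) (a 0) = unary_iterate gs (a 0)"
        using orbit[OF fs(1)] fs(2) by metis
      then show ?thesis
        using h[of _ "fs @ gs"] fs by simp
    qed
    then have "\<exists>n. (\<phi> ^^ n) (a 0) \<in> X" "\<exists>n. (\<phi> ^^ n) (a 0) \<notin> X"
      using X by blast+
    moreover have "(\<phi> ^^ n) (a 0) \<in> A (e 0)" for n
      using FR[of n] by (auto simp: FR_sorted_def sorted_by_def)
    ultimately show False
      using hom FR by blast
  qed
qed

end

theorem theorem5p5:
  fixes I :: "'i set" and A :: "'i \<Rightarrow> 'a set" and F :: "('i, 'a) operation set"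
  assumes "heterogeneous_algebra I A F"
    and "F = (\<Union>\<xi>\<in>I. homogeneous_ops F \<xi>)"
  shows "(\<forall>\<eta>\<in>I. \<forall>e\<in>Omega_at I \<eta>.
            sorted_Ramsey_algebra I A F e \<longleftrightarrow> Ramsey_algebra \<eta> (A \<eta>) (homogeneous_ops F \<eta>)) \<and>
         (\<forall>e\<in>sorts I. e \<notin> Omega I \<longrightarrow>
            (sorted_Ramsey_algebra I A F e \<longleftrightarrow>
               (\<forall>c\<in>A (e 0). \<exists>fs. set fs \<subseteq> unary_ops (homogeneous_ops F (e 0)) \<and>
                  fold (\<lambda>f x. op_fun f [x]) fs c \<in> fixed_points A F (e 0))) \<and>
            (unary_ops (homogeneous_ops F (e 0)) = {} \<longrightarrow>
               fixed_points A F (e 0) = A (e 0) \<and> sorted_Ramsey_algebra I A F e))"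
proof -
  interpret phylumwise_algebra I A F
    by (rule phylumwise_algebra.intro[OF assms(1) phylumwise_algebra_axioms.intro[OF assms(2)]])
  show ?thesis
  proof (intro conjI ballI impI)
    fix \<eta> e assume "\<eta> \<in> I" "e \<in> Omega_at I \<eta>"
    then show "sorted_Ramsey_algebra I A F e \<longleftrightarrow> Ramsey_algebra \<eta> (A \<eta>) (homogeneous_ops F \<eta>)"
      using Ramsey_algebra_imp_sorted_Ramsey_algebra sorted_Ramsey_algebra_imp_Ramsey_algebra
      by (intro iffI)
  next
    fix e assume e: "e \<in> sorts I" "e \<notin> Omega I"
    note iff = sorted_Ramsey_algebra_not_Omega_iff[OF e]
    then show "sorted_Ramsey_algebra I A F e \<longleftrightarrow>
        (\<forall>c\<in>A (e 0). \<exists>fs. set fs \<subseteq> unary_ops (homogeneous_ops F (e 0)) \<and>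
           fold (\<lambda>f x. op_fun f [x]) fs c \<in> fixed_points A F (e 0))" .
    \<comment> \<open>The fixed-point condition is now vacuous, and the empty list of operations is
      the witness.\<close>
    assume "unary_ops (homogeneous_ops F (e 0)) = {}"
    then show "fixed_points A F (e 0) = A (e 0)" "sorted_Ramsey_algebra I A F e"
      by (simp_all add: iff fixed_points_def)
  qed
qed

end
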